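(* Let $R\subseteq S$ be an extension of integral domains and let $G$ be a finite subgroup of $\mathrm{Aut}(S)$ such that $\sigma(R)\subseteq R$ for all $\sigma\in G$ and $|G|\in U(R)$. If $R\subseteq S$ has FICP, then $R^G\subseteq S^G$ has FICP.
   Context: All rings are commutative with unity, and subrings share the unity. $\mathrm{Aut}(S)$ is the group of ring automorphisms of $S$, and $U(R)$ is the group of units of $R$; $|G|\in U(R)$ means that the image of the integer $|G|$ in $R$ is a unit. $S^G=\{s\in S : \sigma(s)=s \text{ for all } \sigma\in G\}$ and $R^G=\{r\in R : \sigma(r)=r \text{ for all } \sigma\in G\}=R\cap S^G$. An extension of integral domains $R\subseteq S$ has the finite length of intermediate chains of domains property (FICP) if each chain (with respect to inclusion) of intermediate rings between $R$ and $S$ is finite. *)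

theory Defs
  imports "HOL-Algebra.Algebra"
begin

text \<open>The ring automorphisms of \<open>S\<close> form a subgroup of the group of bijections of the carrier.
  As in \<^const>\<open>AutoGroup\<close>, they are taken to be extensional: otherwise functions that differ
  only outside the carrier would count as distinct, and orders of groups of automorphisms would
  be wrong.\<close>

definition RingAut :: "('a, 'b) ring_scheme \<Rightarrow> ('a \<Rightarrow> 'a) monoid"
  where "RingAut S =
    BijGroup (carrier S) \<lparr>carrier := ring_iso S S \<inter> extensional (carrier S)\<rparr>"

definition fixed_points :: "('a \<Rightarrow> 'a) set \<Rightarrow> 'a set \<Rightarrow> 'a set"
  where "fixed_points G A = {x \<in> A. \<forall>\<sigma>\<in>G. \<sigma> x = x}"

definition domain_extension :: "'a set \<Rightarrow> ('a, 'b) ring_scheme \<Rightarrow> bool"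
  where "domain_extension R S \<longleftrightarrow> domain S \<and> subdomain R S"

definition intermediate_rings :: "'a set \<Rightarrow> ('a, 'b) ring_scheme \<Rightarrow> 'a set set"
  where "intermediate_rings R S = {T. subring T S \<and> R \<subseteq> T}"

text \<open>The property is only attributed to extensions of integral domains, so being one is
  part of the definition.\<close>

definition FICP :: "'a set \<Rightarrow> ('a, 'b) ring_scheme \<Rightarrow> bool"
  where "FICP R S \<longleftrightarrow> domain_extension R S \<and>
    (\<forall>C. subset.chain (intermediate_rings R S) C \<longrightarrow> finite C)"

lemma (in ring) subgroup_ring_iso:
  "subgroup (ring_iso R R \<inter> extensional (carrier R)) (BijGroup (carrier R))"
proof (rule subgroup.intro)
  show "ring_iso R R \<inter> extensional (carrier R) \<subseteq> carrier (BijGroup (carrier R))"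
    by (auto simp: BijGroup_def Bij_def ring_iso_def)
next
  fix f g
  assume f: "f \<in> ring_iso R R \<inter> extensional (carrier R)"
    and g: "g \<in> ring_iso R R \<inter> extensional (carrier R)"
  have "f \<circ> g \<in> ring_iso R R"
    using f g ring_iso_set_trans by blast
  then have "compose (carrier R) f g \<in> ring_iso R R"
    by (rule ring_iso_restrict) (simp add: compose_def)
  moreover have "f \<in> Bij (carrier R)" "g \<in> Bij (carrier R)"
    using f g by (auto simp: Bij_def ring_iso_def)
  ultimately show "f \<otimes>\<^bsub>BijGroup (carrier R)\<^esub> g \<in> ring_iso R R \<inter> extensional (carrier R)"
    by (simp add: BijGroup_def)
next
  have "(\<lambda>x\<in>carrier R. x) \<in> ring_iso R R"
    by (rule ring_iso_restrict[OF ring_iso_set_refl]) simp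
  then show "\<one>\<^bsub>BijGroup (carrier R)\<^esub> \<in> ring_iso R R \<inter> extensional (carrier R)"
    by (simp add: BijGroup_def)
next
  fix f
  assume f: "f \<in> ring_iso R R \<inter> extensional (carrier R)"
  then have B: "f \<in> Bij (carrier R)"
    by (auto simp: Bij_def ring_iso_def)
  have "inv_into (carrier R) f \<in> ring_iso R R"
    using f ring_iso_set_sym[OF ring_axioms] by blast
  then have "restrict (inv_into (carrier R) f) (carrier R) \<in> ring_iso R R"
    by (rule ring_iso_restrict) simp
  then show "inv\<^bsub>BijGroup (carrier R)\<^esub> f \<in> ring_iso R R \<inter> extensional (carrier R)"
    by (simp add: inv_BijGroup[OF B])
qed

lemma (in ring) group_RingAut: "group (RingAut R)"
  unfolding RingAut_def
  by (rule subgroup.subgroup_is_group[OF subgroup_ring_iso group_BijGroup])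

end

theory Submission
  imports Defs
begin

text \<open>
  The fixed ring \<open>S\<^sup>G\<close> is compared with \<open>S\<close> by extension and contraction.  A ring \<open>T\<close> with
  \<open>R\<^sup>G \<subseteq> T \<subseteq> S\<^sup>G\<close> extends to \<open>RT\<close>, the set of finite sums \<open>\<Sum> r\<^sub>i t\<^sub>i\<close> with \<open>r\<^sub>i \<in> R\<close> and \<open>t\<^sub>i \<in> T\<close>,
  which is a ring between \<open>R\<close> and \<open>S\<close>.  Extension is monotone, so it sends a chain between \<open>R\<^sup>G\<close>
  and \<open>S\<^sup>G\<close> to a chain between \<open>R\<close> and \<open>S\<close>, and the latter is finite.  It remains to see that
  extension is injective, which holds because contraction undoes it: \<open>RT \<inter> S\<^sup>G = T\<close>.

  This is an averaging argument.  The trace \<open>x \<mapsto> \<Sum>\<^bsub>\<sigma> \<in> G\<^esub> \<sigma>(x)\<close> is \<open>S\<^sup>G\<close>-linear and maps \<open>R\<close> into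
  \<open>R\<^sup>G\<close>.  Hence it sends \<open>\<Sum> r\<^sub>i t\<^sub>i\<close> to \<open>\<Sum> tr(r\<^sub>i) t\<^sub>i\<close>, that is, it maps \<open>RT\<close> into \<open>T\<close>.  On
  \<open>S\<^sup>G\<close> it is multiplication by \<open>|G|\<close>.  For \<open>x \<in> RT \<inter> S\<^sup>G\<close> it follows that \<open>|G| x \<in> T\<close>, and
  \<open>|G|\<close> can be cancelled because its inverse lies in \<open>R\<^sup>G \<subseteq> T\<close>.

  The finite sums of products are formalized by \<^const>\<open>ideal_prod\<close>, whose definition makes sense
  for arbitrary subsets of a ring.
\<close>

section \<open>Subrings and their products\<close>

lemma (in ring) subring_of_subring:
  assumes H: "subring H R" and K: "subring K (R\<lparr>carrier := H\<rparr>)"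
  shows "subring K R"
proof -
  have "K \<subseteq> H"
    using subringE(1)[OF K] by simp
  moreover have "ring (R\<lparr>carrier := K\<rparr>)"
    using ring.subring_is_ring[OF subring_is_ring[OF H] K] by simp
  ultimately show ?thesis
    using subringE(1)[OF H] by (intro ring_incl_imp_subring) auto
qed

lemma (in ring) subring_restrict:
  assumes H: "subring H R" and K: "subring K R" and "K \<subseteq> H"
  shows "subring K (R\<lparr>carrier := H\<rparr>)"
proof (rule ring.ring_incl_imp_subring[OF subring_is_ring[OF H]])
  show "ring (R\<lparr>carrier := H, carrier := K\<rparr>)"
    using subring_is_ring[OF K] by simp
qed (use \<open>K \<subseteq> H\<close> in simp)

lemma ideal_prod_mono:
  assumes "J \<subseteq> J'"
  shows "ideal_prod R I J \<subseteq> ideal_prod R I J'"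
proof
  fix x
  assume "x \<in> ideal_prod R I J"
  then show "x \<in> ideal_prod R I J'"
    by induct (use assms in \<open>auto intro: ideal_prod.intros\<close>)
qed

context cring
begin

context
  fixes A B
  assumes A: "subring A R" and B: "subring B R"
begin

lemma subring_prod_closed: "x \<in> A \<cdot> B \<Longrightarrow> x \<in> carrier R"
  by (induct rule: ideal_prod.induct) (use subringE(1)[OF A] subringE(1)[OF B] in auto)

lemma subset_subring_prod_left: "A \<subseteq> A \<cdot> B"
proof
  fix a
  assume "a \<in> A"
  then have "a \<otimes> \<one> \<in> A \<cdot> B"
    using subringE(3)[OF B] by (rule ideal_prod.prod)
  with \<open>a \<in> A\<close> show "a \<in> A \<cdot> B"
    using subringE(1)[OF A] by auto
qed

lemma subset_subring_prod_right: "B \<subseteq> A \<cdot> B"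
proof
  fix b
  assume "b \<in> B"
  with subringE(3)[OF A] have "\<one> \<otimes> b \<in> A \<cdot> B"
    by (rule ideal_prod.prod)
  with \<open>b \<in> B\<close> show "b \<in> A \<cdot> B"
    using subringE(1)[OF B] by auto
qed

text \<open>Commutativity enters here: \<open>(ab)(a'b') = (aa')(bb')\<close> is again a generator.  By
  distributivity in the other factor this gives closure under all products.\<close>

lemma subring_prod_m_closed_generator:
  assumes a: "a \<in> A" and b: "b \<in> B" and y: "y \<in> A \<cdot> B"
  shows "a \<otimes> b \<otimes> y \<in> A \<cdot> B"
  using y
proof induct
  case (prod a' b')
  have carr: "a \<in> carrier R" "b \<in> carrier R" "a' \<in> carrier R" "b' \<in> carrier R"
    using a b prod subringE(1)[OF A] subringE(1)[OF B] by auto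
  have "(a \<otimes> a') \<otimes> (b \<otimes> b') \<in> A \<cdot> B"
    using a b prod subringE(6)[OF A] subringE(6)[OF B] by (auto intro: ideal_prod.prod)
  also have "(a \<otimes> a') \<otimes> (b \<otimes> b') = a \<otimes> b \<otimes> (a' \<otimes> b')"
    using carr by (simp add: m_ac)
  finally show ?case .
next
  case (sum y z)
  moreover have "a \<in> carrier R" "b \<in> carrier R"
    using a b subringE(1)[OF A] subringE(1)[OF B] by auto
  ultimately show ?case
    by (simp add: r_distr subring_prod_closed ideal_prod.sum)
qed

lemma subring_subring_prod: "subring (A \<cdot> B) R"
proof (rule subringI)
  show "A \<cdot> B \<subseteq> carrier R"
    using subring_prod_closed by blast
  show "\<one> \<in> A \<cdot> B"
    using subset_subring_prod_left subringE(3)[OF A] by blast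
  show "x \<oplus> y \<in> A \<cdot> B" if "x \<in> A \<cdot> B" "y \<in> A \<cdot> B" for x y
    using that by (rule ideal_prod.sum)
  show mult: "x \<otimes> y \<in> A \<cdot> B" if x: "x \<in> A \<cdot> B" and y: "y \<in> A \<cdot> B" for x y
    using x
  proof induct
    case (prod a b)
    then show ?case
      using y by (rule subring_prod_m_closed_generator)
  next
    case (sum x z)
    then show ?case
      using y by (simp add: l_distr subring_prod_closed ideal_prod.sum)
  qed
  show "\<ominus> x \<in> A \<cdot> B" if x: "x \<in> A \<cdot> B" for x
  proof -
    have "\<ominus> \<one> \<in> A \<cdot> B"
      using subset_subring_prod_left subringE(3,5)[OF A] by blast
    then have "\<ominus> \<one> \<otimes> x \<in> A \<cdot> B"
      using x by (rule mult)
    then show ?thesis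
      using subring_prod_closed[OF x] by (simp add: l_minus)
  qed
qed

end

end

section \<open>The trace of a finite group of automorphisms\<close>

locale finite_automorphism_group = cring S for S :: "('a, 'b) ring_scheme" (structure) +
  fixes G :: "('a \<Rightarrow> 'a) set"
  assumes subgroup: "subgroup G (RingAut S)" and finite_group: "finite G"
begin

lemma automorphism: "g \<in> G \<Longrightarrow> g \<in> ring_iso S S \<inter> extensional (carrier S)"
  using subgroup.subset[OF subgroup] by (auto simp: RingAut_def)

lemma automorphism_hom: "g \<in> G \<Longrightarrow> ring_hom_cring S S g"
  using automorphism
  by (intro ring_hom_cring.intro ring_hom_cring_axioms.intro)
    (auto simp: ring_iso_def cring_axioms)

context
  fixes g
  assumes g: "g \<in> G"
begin

interpretation g: ring_hom_cring S S g
  using g by (rule automorphism_hom)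

lemma apply_closed: "x \<in> carrier S \<Longrightarrow> g x \<in> carrier S"
  by simp

lemma apply_add: "x \<in> carrier S \<Longrightarrow> y \<in> carrier S \<Longrightarrow> g (x \<oplus> y) = g x \<oplus> g y"
  by simp

lemma apply_mult: "x \<in> carrier S \<Longrightarrow> y \<in> carrier S \<Longrightarrow> g (x \<otimes> y) = g x \<otimes> g y"
  by simp

lemma apply_uminus: "x \<in> carrier S \<Longrightarrow> g (\<ominus> x) = \<ominus> g x"
  by simp

lemma apply_nat_multiple_one: "g ([(n::nat)] \<cdot> \<one>) = [n] \<cdot> \<one>"
  by (induct n) simp_all

lemma apply_one: "g \<one> = \<one>"
  by simp

end

lemma compose_closed:
  assumes "g \<in> G" "h \<in> G"
  shows "compose (carrier S) g h \<in> G"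
proof -
  have "g \<in> Bij (carrier S)" "h \<in> Bij (carrier S)"
    using assms automorphism by (auto simp: Bij_def ring_iso_def)
  then show ?thesis
    using subgroup.m_closed[OF subgroup assms] by (simp add: RingAut_def BijGroup_def)
qed

text \<open>Composition with \<open>h\<close> is injective because automorphisms are bijective and are determined by
  their values on the carrier; it is surjective because \<open>G\<close> is finite.\<close>

lemma left_translation_bij:
  assumes h: "h \<in> G"
  shows "inj_on (compose (carrier S) h) G" "compose (carrier S) h ` G = G"
proof -
  show inj: "inj_on (compose (carrier S) h) G"
  proof (rule inj_onI)
    fix g k
    assume G: "g \<in> G" "k \<in> G"
      and eq: "compose (carrier S) h g = compose (carrier S) h k"
    have "inj_on h (carrier S)"
      using automorphism[OF h] by (auto simp: ring_iso_def bij_betw_def)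
    moreover have "h (g x) = h (k x)" if "x \<in> carrier S" for x
      using fun_cong[OF eq, of x] that by (simp add: compose_def)
    ultimately have "g x = k x" if "x \<in> carrier S" for x
      using that G by (meson inj_onD apply_closed)
    then show "g = k"
      using automorphism G by (intro extensionalityI[of _ "carrier S"]) auto
  qed
  show "compose (carrier S) h ` G = G"
    by (rule endo_inj_surj[OF finite_group _ inj]) (auto intro: compose_closed[OF h])
qed

lemma fixed_pointsI: "x \<in> A \<Longrightarrow> (\<And>g. g \<in> G \<Longrightarrow> g x = x) \<Longrightarrow> x \<in> fixed_points G A"
  by (simp add: fixed_points_def)

lemma fixed_pointsD: "x \<in> fixed_points G A \<Longrightarrow> g \<in> G \<Longrightarrow> g x = x"
  by (simp add: fixed_points_def)

lemma fixed_points_subset: "fixed_points G A \<subseteq> A"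
  by (auto simp: fixed_points_def)

lemma fixed_points_mono: "A \<subseteq> B \<Longrightarrow> fixed_points G A \<subseteq> fixed_points G B"
  by (auto simp: fixed_points_def)

lemma subring_fixed_points:
  assumes A: "subring A S"
  shows "subring (fixed_points G A) S"
proof -
  note carr = subsetD[OF subringE(1)[OF A]]
  show ?thesis
  proof (rule subringI)
    show "fixed_points G A \<subseteq> carrier S"
      using carr fixed_points_subset by blast
    show "\<one> \<in> fixed_points G A"
      using subringE(3)[OF A] apply_one by (rule fixed_pointsI)
    fix x
    assume x: "x \<in> fixed_points G A"
    then have "x \<in> A"
      using fixed_points_subset by blast
    then show "\<ominus> x \<in> fixed_points G A"
      using subringE(5)[OF A]
      by (intro fixed_pointsI) (simp_all add: apply_uminus[of _ x] carr fixed_pointsD[OF x])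
    fix y
    assume y: "y \<in> fixed_points G A"
    then have "y \<in> A"
      using fixed_points_subset by blast
    show "x \<oplus> y \<in> fixed_points G A"
      using \<open>x \<in> A\<close> \<open>y \<in> A\<close> subringE(7)[OF A]
      by (intro fixed_pointsI)
        (simp_all add: apply_add[of _ x y] carr fixed_pointsD[OF x] fixed_pointsD[OF y])
    show "x \<otimes> y \<in> fixed_points G A"
      using \<open>x \<in> A\<close> \<open>y \<in> A\<close> subringE(6)[OF A]
      by (intro fixed_pointsI)
        (simp_all add: apply_mult[of _ x y] carr fixed_pointsD[OF x] fixed_pointsD[OF y])
  qed
qed

definition trace :: "'a \<Rightarrow> 'a"
  where "trace x = (\<Oplus>g\<in>G. g x)"

lemma trace_add:
  assumes "x \<in> carrier S" "y \<in> carrier S"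
  shows "trace (x \<oplus> y) = trace x \<oplus> trace y"
proof -
  have "trace (x \<oplus> y) = (\<Oplus>g\<in>G. g x \<oplus> g y)"
    unfolding trace_def using assms
    by (intro finsum_cong' refl) (auto intro: apply_closed apply_add)
  also have "\<dots> = trace x \<oplus> trace y"
    unfolding trace_def using assms by (intro finsum_addf) (auto intro: apply_closed)
  finally show ?thesis .
qed

lemma trace_mult_fixed:
  assumes x: "x \<in> carrier S" and y: "y \<in> fixed_points G (carrier S)"
  shows "trace (x \<otimes> y) = trace x \<otimes> y"
proof -
  have y': "y \<in> carrier S"
    using y fixed_points_subset by blast
  have "trace (x \<otimes> y) = (\<Oplus>g\<in>G. g x \<otimes> y)"
    unfolding trace_def using x y'
    by (intro finsum_cong' refl)
      (auto intro: apply_closed simp: apply_mult[of _ x y] fixed_pointsD[OF y])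
  also have "\<dots> = trace x \<otimes> y"
    unfolding trace_def using x y' finite_group
    by (intro finsum_ldistr[symmetric]) (auto intro: apply_closed)
  finally show ?thesis .
qed

lemma trace_fixed:
  assumes x: "x \<in> fixed_points G (carrier S)"
  shows "trace x = [card G] \<cdot> \<one> \<otimes> x"
proof -
  have x': "x \<in> carrier S"
    using x fixed_points_subset by blast
  have "trace x = (\<Oplus>g\<in>G. x)"
    unfolding trace_def using x' by (intro finsum_cong') (auto simp: fixed_pointsD[OF x])
  also have "\<dots> = [card G] \<cdot> x"
    using x' by (rule add.finprod_const)
  also have "\<dots> = [card G] \<cdot> \<one> \<otimes> x"
    using x' by (simp add: add_pow_ldistr)
  finally show ?thesis .
qed

text \<open>Applying \<open>h \<in> G\<close> to a trace only permutes its summands.\<close>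

lemma apply_trace:
  assumes h: "h \<in> G" and x: "x \<in> carrier S"
  shows "h (trace x) = trace x"
proof -
  interpret h: ring_hom_cring S S h
    using h by (rule automorphism_hom)
  have "h (trace x) = (\<Oplus>g\<in>G. (h \<circ> (\<lambda>g. g x)) g)"
    unfolding trace_def using x by (intro h.hom_finsum) (auto intro: apply_closed)
  also have "\<dots> = (\<Oplus>g\<in>G. compose (carrier S) h g x)"
    using x by (simp add: compose_def o_def)
  also have "\<dots> = (\<Oplus>g\<in>compose (carrier S) h ` G. g x)"
    using x left_translation_bij[OF h]
    by (intro finsum_reindex[symmetric]) (auto intro: apply_closed)
  also have "\<dots> = trace x"
    by (simp add: left_translation_bij[OF h] trace_def)
  finally show ?thesis .
qed

lemma trace_in_fixed_points:
  assumes A: "subring A S" and stable: "\<And>g. g \<in> G \<Longrightarrow> g ` A \<subseteq> A" and x: "x \<in> A"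
  shows "trace x \<in> fixed_points G A"
proof -
  have "(\<Oplus>g\<in>F. g x) \<in> A" if "finite F" "F \<subseteq> G" for F
    using that
  proof induct
    case empty
    then show ?case
      using subringE(2)[OF A] by simp
  next
    case (insert g F)
    have "k x \<in> A" if "k \<in> insert g F" for k
      using that insert stable x by blast
    then show ?case
      using insert subringE(1,7)[OF A] by (subst finsum_insert) auto
  qed
  then have "trace x \<in> A"
    unfolding trace_def using finite_group by blast
  moreover have "x \<in> carrier S"
    using subringE(1)[OF A] x by blast
  ultimately show ?thesis
    by (simp add: fixed_points_def apply_trace)
qed

section \<open>Extension followed by contraction\<close>

text \<open>Automorphisms fix the integer multiples of \<open>\<one>\<close>, hence also their inverses.\<close>

lemma fixed_inverse_of_nat_multiple:
  assumes A: "subring A S" and u: "u \<in> A" "u \<otimes> ([(n::nat)] \<cdot> \<one>) = \<one>"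
  shows "u \<in> fixed_points G A"
proof -
  have carr: "u \<in> carrier S"
    using u(1) subringE(1)[OF A] by blast
  have "g u = u" if g: "g \<in> G" for g
  proof -
    have "g u \<otimes> ([n] \<cdot> \<one>) = g (u \<otimes> ([n] \<cdot> \<one>))"
      using carr g by (simp add: apply_mult[of g] apply_nat_multiple_one[of g])
    also have "\<dots> = \<one>"
      using g by (simp add: u(2) apply_one[of g])
    finally have inv: "g u \<otimes> ([n] \<cdot> \<one>) = \<one>" .
    \<comment> \<open>The inverse of \<open>n\<close> is unique.\<close>
    show ?thesis
      by (rule inv_unique[OF inv])
        (use carr u(2) apply_closed[OF g] in \<open>simp_all add: m_comm\<close>)
  qed
  with u(1) show ?thesis
    by (simp add: fixed_points_def)
qed

context
  fixes A T
  assumes A: "subring A S" and stable: "\<And>g. g \<in> G \<Longrightarrow> g ` A \<subseteq> A"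
    and T: "subring T S"
    and lower: "fixed_points G A \<subseteq> T" and upper: "T \<subseteq> fixed_points G (carrier S)"
begin

text \<open>By linearity over the fixed ring, the trace of \<open>\<Sum> a\<^sub>i t\<^sub>i\<close> is \<open>\<Sum> tr(a\<^sub>i) t\<^sub>i\<close>, where
  \<open>tr(a\<^sub>i) \<in> A\<^sup>G \<subseteq> T\<close>.\<close>

lemma trace_subring_prod:
  assumes "x \<in> A \<cdot> T"
  shows "trace x \<in> T"
  using assms
proof induct
  case (prod a t)
  then have "trace a \<in> T"
    using trace_in_fixed_points[OF A stable] lower by blast
  moreover have "trace (a \<otimes> t) = trace a \<otimes> t"
    using prod upper subringE(1)[OF A] by (intro trace_mult_fixed) auto
  ultimately show ?case
    using prod subringE(6)[OF T] by simp
next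
  case (sum x y)
  then show ?case
    using subringE(7)[OF T] by (simp add: trace_add subring_prod_closed[OF A T])
qed

lemma subring_prod_Int_fixed_points:
  assumes unit: "[card G] \<cdot> \<one> \<in> Units (S\<lparr>carrier := A\<rparr>)"
  shows "A \<cdot> T \<inter> fixed_points G (carrier S) = T"
proof
  show "T \<subseteq> A \<cdot> T \<inter> fixed_points G (carrier S)"
    using subset_subring_prod_right[OF A T] upper by blast
  obtain u where u: "u \<in> A" "u \<otimes> ([card G] \<cdot> \<one>) = \<one>"
    using unit by (auto simp: Units_def)
  have "u \<in> T"
    using fixed_inverse_of_nat_multiple[OF A u] lower by blast
  show "A \<cdot> T \<inter> fixed_points G (carrier S) \<subseteq> T"
  proof
    fix x
    assume x: "x \<in> A \<cdot> T \<inter> fixed_points G (carrier S)"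
    then have carr: "x \<in> carrier S" "u \<in> carrier S"
      using u(1) subringE(1)[OF A] fixed_points_subset by auto
    have "u \<otimes> trace x \<in> T"
      using \<open>u \<in> T\<close> x trace_subring_prod subringE(6)[OF T] by blast
    also have "u \<otimes> trace x = u \<otimes> ([card G] \<cdot> \<one>) \<otimes> x"
      using x carr by (simp add: trace_fixed m_assoc)
    also have "\<dots> = x"
      using u(2) carr by simp
    finally show "x \<in> T" .
  qed
qed

end

text \<open>Extension is monotone, and injective because contraction is a left inverse, so a chain below
  is no larger than the chain of its extensions.\<close>

lemma finite_chain_of_fixed_rings:
  assumes A: "subring A S" and stable: "\<And>g. g \<in> G \<Longrightarrow> g ` A \<subseteq> A"
    and unit: "[card G] \<cdot> \<one> \<in> Units (S\<lparr>carrier := A\<rparr>)"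
    and finite_chains: "\<And>C. subset.chain (intermediate_rings A S) C \<Longrightarrow> finite C"
    and C: "subset.chain
      (intermediate_rings (fixed_points G A) (S\<lparr>carrier := fixed_points G (carrier S)\<rparr>)) C"
  shows "finite C"
proof -
  have T: "subring T S \<and> fixed_points G A \<subseteq> T \<and> T \<subseteq> fixed_points G (carrier S)"
    if "T \<in> C" for T
  proof -
    have T: "subring T (S\<lparr>carrier := fixed_points G (carrier S)\<rparr>)" "fixed_points G A \<subseteq> T"
      using that C by (auto simp: subset_chain_def intermediate_rings_def)
    then show ?thesis
      using subring_of_subring[OF subring_fixed_points[OF carrier_is_subring] T(1)]
        subringE(1)[OF T(1)] by simp
  qed
  have "subset.chain (intermediate_rings A S) ((\<lambda>T. A \<cdot> T) ` C)"
    unfolding subset_chain_def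
  proof (intro conjI ballI subsetI)
    fix B
    assume "B \<in> (\<lambda>T. A \<cdot> T) ` C"
    then obtain T where "T \<in> C" "B = A \<cdot> T"
      by blast
    then show "B \<in> intermediate_rings A S"
      using T subring_subring_prod[OF A, of T] subset_subring_prod_left[OF A, of T]
      by (simp add: intermediate_rings_def)
  next
    fix B B'
    assume "B \<in> (\<lambda>T. A \<cdot> T) ` C" "B' \<in> (\<lambda>T. A \<cdot> T) ` C"
    then obtain T T' where "T \<in> C" "T' \<in> C" and B: "B = A \<cdot> T" "B' = A \<cdot> T'"
      by blast
    then have "T \<subseteq> T' \<or> T' \<subseteq> T"
      using C by (simp add: subset_chain_def)
    then show "B \<subseteq> B' \<or> B' \<subseteq> B"
      unfolding B using ideal_prod_mono[of T T' S A] ideal_prod_mono[of T' T S A] by argo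
  qed
  then have "finite ((\<lambda>T. A \<cdot> T) ` C)"
    by (rule finite_chains)
  moreover have "A \<cdot> T \<inter> fixed_points G (carrier S) = T" if "T \<in> C" for T
    using T[OF that] by (intro subring_prod_Int_fixed_points[OF A stable _ _ _ unit]) auto
  then have "inj_on (\<lambda>T. A \<cdot> T) C"
    by (intro inj_on_inverseI[where g = "\<lambda>B. B \<inter> fixed_points G (carrier S)"])
  ultimately show ?thesis
    by (rule finite_imageD)
qed

end

section \<open>Descent of FICP to the fixed rings\<close>

theorem theorem3p6:
  fixes S :: "('a, 'b) ring_scheme" and R :: "'a set" and G :: "('a \<Rightarrow> 'a) set"
  assumes "domain_extension R S"
    and "subgroup G (RingAut S)"
    and "finite G"
    and "\<And>\<sigma>. \<sigma> \<in> G \<Longrightarrow> \<sigma> ` R \<subseteq> R"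
    and "[card G] \<cdot>\<^bsub>S\<^esub> \<one>\<^bsub>S\<^esub> \<in> Units (S\<lparr>carrier := R\<rparr>)"
    and "FICP R S"
  shows "FICP (fixed_points G R) (S\<lparr>carrier := fixed_points G (carrier S)\<rparr>)"
proof -
  interpret domain S
    using assms(1) by (simp add: domain_extension_def)
  interpret finite_automorphism_group S G
    using assms(2,3)
    by (intro finite_automorphism_group.intro finite_automorphism_group_axioms.intro cring_axioms)
  have R: "subring R S"
    using assms(1) by (simp add: domain_extension_def subdomain_def subcring_def)
  have fixed: "subring (fixed_points G (carrier S)) S" "subring (fixed_points G R) S"
    using subring_fixed_points carrier_is_subring R by auto
  have "domain (S\<lparr>carrier := fixed_points G (carrier S)\<rparr>)"
    by (rule subring_is_domain[OF fixed(1)])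
  moreover have "subring (fixed_points G R) (S\<lparr>carrier := fixed_points G (carrier S)\<rparr>)"
    by (rule subring_restrict[OF fixed fixed_points_mono[OF subringE(1)[OF R]]])
  ultimately have "domain_extension (fixed_points G R) (S\<lparr>carrier := fixed_points G (carrier S)\<rparr>)"
    by (simp add: domain_extension_def domain.subdomainI')
  moreover have "finite C" if "subset.chain (intermediate_rings R S) C" for C
    using assms(6) that by (simp add: FICP_def)
  ultimately show ?thesis
    unfolding FICP_def using finite_chain_of_fixed_rings[OF R assms(4,5)] by blast
qed

end
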